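(* Let $Z$ be a fake weighted projective space of dimension $n$ with $\operatorname{Cl}(Z)=\mathbb{Z}\oplus\mathbb{Z}/\mu_1\mathbb{Z}\oplus\dots\oplus\mathbb{Z}/\mu_r\mathbb{Z}$ and degree matrix $Q=[\omega_0,\dots,\omega_n]$, where $\omega_i=(w_i,\eta_i)$ and $\eta_i=(\eta_{i1},\dots,\eta_{ir})$. For $0\le i\le n$ and $1\le k\le r$ let $0\le\eta'_{ik}<\mu_k$ be the integer representing $\eta_{ik}\in\mathbb{Z}/\mu_k\mathbb{Z}$, and set $$L:=\operatorname{lcm}(w_0,\dots,w_n),\qquad M_k:=\frac{\mu_k}{\gcd\left(\mu_k,\frac{L}{w_0}\eta'_{0k},\dots,\frac{L}{w_n}\eta'_{nk}\right)},\quad 1\le k\le r.$$ Then a partition $p_1\sqcup\dots\sqcup p_s=\{0,\dots,n\}$ is a nef-partition of $Z$ if and only if $$\begin{cases}L\ \Big|\ \sum_{i\in p_j}w_i, & j=1,\dots,s,\\[4pt] M_k\ \Big|\ \dfrac{\sum_{i\in p_j}w_i}{L}, & j=1,\dots,s,\ k=1,\dots,r,\\[4pt] \sum_{i\in p_j}\eta_{ik}=0\in\mathbb{Z}/\mu_k\mathbb{Z}, & j=1,\dots,s,\ k=1,\dots,r.\end{cases}$$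
   Context: A fake weighted projective space (fwps) of dimension $n$ is an $n$-dimensional $\mathbb{Q}$-factorial toric Fano variety $Z$ of Picard number one, over the base field $\mathbb{K}$. Its divisor class group is presented in invariant factor form $\operatorname{Cl}(Z)=\mathbb{Z}\oplus\mathbb{Z}/\mu_1\mathbb{Z}\oplus\dots\oplus\mathbb{Z}/\mu_r\mathbb{Z}$, meaning $\mu_r\mid\mu_{r-1}\mid\dots\mid\mu_1$. Let $\omega_i=(w_i,\eta_i)\in\operatorname{Cl}(Z)$, $i=0,\dots,n$, be the classes of the torus-invariant prime divisors, with $1\le w_0\le\dots\le w_n$ and $\eta_i\in\mathbb{Z}/\mu_1\mathbb{Z}\oplus\dots\oplus\mathbb{Z}/\mu_r\mathbb{Z}$. Then $Q=[\omega_0,\dots,\omega_n]$ is a degree matrix of $Z$: any $n$ of the $\omega_i$ generate $\operatorname{Cl}(Z)$ as a group, and $Z$ is the quotient of $\mathbb{K}^{n+1}\setminus\{0\}$ by the diagonal action, with weights $\omega_i$, of the quasitorus with character group $\operatorname{Cl}(Z)$. $\operatorname{Pic}(Z)\subseteq\operatorname{Cl}(Z)$ is the subgroup of Cartier divisor classes. A nef-partition of $Z$ is a partition $p_1\sqcup\dots\sqcup p_s=\{0,\dots,n\}$ such that $\omega_{p_j}:=\sum_{i\in p_j}\omega_i\in\operatorname{Pic}(Z)$ for $j=1,\dots,s$, and such that moreover $\omega_{p_j}\ne\omega_i$ for all $j$ and all $i$ (in particular no block has size one).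
   Formalization: The condition that ω_{p_j} ≠ ω_i for all j and i is added to the right-hand side, since otherwise P^1 with blocks {0},{1} meets the displayed conditions without being a nef-partition; the base field K is taken algebraically closed of characteristic zero. *)

theory Defs
  imports
    "HOL-Algebra.Algebra"
    "HOL-Computational_Algebra.Polynomial"
begin

section \<open>The class group and degree matrices\<close>

text \<open>The group \<open>\<int> \<oplus> \<int>/\<mu>\<^sub>1\<int> \<oplus> \<dots> \<oplus> \<int>/\<mu>\<^sub>r\<int>\<close>, written multiplicatively as all groups of
  HOL-Algebra.  For \<open>\<mu>\<^sub>k \<ge> 1\<close> the carrier of \<^const>\<open>integer_mod_group\<close> is \<open>{0..<\<mu>\<^sub>k}\<close>, so an element
  of \<open>\<int>/\<mu>\<^sub>k\<int>\<close> is its own representative in that range.\<close>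

definition Cl :: "nat \<Rightarrow> (nat \<Rightarrow> nat) \<Rightarrow> (int \<times> (nat \<Rightarrow> int)) monoid" where
  "Cl r \<mu> = integer_group \<times>\<times> product_group {1..r} (\<lambda>k. integer_mod_group (\<mu> k))"

text \<open>The matrices \<open>[\<omega>\<^sub>0, \<dots>, \<omega>\<^sub>n]\<close> that are degree matrices of \<open>n\<close>-dimensional fake weighted
  projective spaces with class group \<^term>\<open>Cl r \<mu>\<close> in invariant factor form, the weights being
  positive and ordered.\<close>

definition degree_matrix ::
  "nat \<Rightarrow> nat \<Rightarrow> (nat \<Rightarrow> nat) \<Rightarrow> (nat \<Rightarrow> int \<times> (nat \<Rightarrow> int)) \<Rightarrow> bool" where
  "degree_matrix n r \<mu> \<omega> \<longleftrightarrow>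
     (\<forall>k\<in>{1..r}. 1 \<le> \<mu> k) \<and> (\<forall>k\<in>{1..<r}. \<mu> (Suc k) dvd \<mu> k) \<and>
     (\<forall>i\<in>{0..n}. \<omega> i \<in> carrier (Cl r \<mu>)) \<and>
     1 \<le> fst (\<omega> 0) \<and> (\<forall>i<n. fst (\<omega> i) \<le> fst (\<omega> (Suc i))) \<and>
     (\<forall>I\<subseteq>{0..n}. card I = n \<longrightarrow> generate (Cl r \<mu>) (\<omega> ` I) = carrier (Cl r \<mu>))"


section \<open>Affine space without the origin\<close>

definition punctured_space :: "nat \<Rightarrow> (nat \<Rightarrow> 'k::field) set" where
  "punctured_space n = {x \<in> {0..n} \<rightarrow>\<^sub>E UNIV. \<exists>i\<in>{0..n}. x i \<noteq> 0}"

definition torus :: "nat \<Rightarrow> (nat \<Rightarrow> 'k::field) set" where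
  "torus n = {x \<in> {0..n} \<rightarrow>\<^sub>E UNIV. \<forall>i\<in>{0..n}. x i \<noteq> 0}"

text \<open>Polynomials in the coordinates \<open>x\<^sub>0, \<dots>, x\<^sub>n\<close>, as functions (the field is going to be infinite).\<close>

inductive_set polynomial_functions :: "nat \<Rightarrow> ((nat \<Rightarrow> 'k::field) \<Rightarrow> 'k) set" for n :: nat where
  const: "(\<lambda>x. c) \<in> polynomial_functions n"
| coord: "i \<le> n \<Longrightarrow> (\<lambda>x. x i) \<in> polynomial_functions n"
| add: "f \<in> polynomial_functions n \<Longrightarrow> g \<in> polynomial_functions n \<Longrightarrow>
    (\<lambda>x. f x + g x) \<in> polynomial_functions n"
| mult: "f \<in> polynomial_functions n \<Longrightarrow> g \<in> polynomial_functions n \<Longrightarrow>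
    (\<lambda>x. f x * g x) \<in> polynomial_functions n"

definition zariski_open :: "nat \<Rightarrow> (nat \<Rightarrow> 'k::field) set \<Rightarrow> bool" where
  "zariski_open n V \<longleftrightarrow>
     (\<exists>F\<subseteq>polynomial_functions n. V = {x \<in> punctured_space n. \<exists>f\<in>F. f x \<noteq> 0})"

definition regular :: "nat \<Rightarrow> (nat \<Rightarrow> 'k::field) set \<Rightarrow> ((nat \<Rightarrow> 'k) \<Rightarrow> 'k) \<Rightarrow> bool" where
  "regular n V u \<longleftrightarrow>
     (\<forall>x\<in>V. \<exists>V'\<subseteq>V. zariski_open n V' \<and> x \<in> V' \<and>
       (\<exists>g\<in>polynomial_functions n. \<exists>h\<in>polynomial_functions n.
          \<forall>y\<in>V'. h y \<noteq> 0 \<and> u y = g y / h y))"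


section \<open>The quotient by the quasitorus\<close>

text \<open>In the following \<open>G\<close> is the class group and \<open>\<omega>\<close> the degree matrix.  Over an algebraically
  closed field of characteristic zero, the points of the quasitorus with character group \<open>G\<close> are the
  homomorphisms from \<open>G\<close> to the multiplicative group of the field; the value of the character
  \<open>w \<in> G\<close> at the point \<open>h\<close> is \<open>h w\<close>.\<close>

definition mult_group :: "'k::field monoid" where
  "mult_group = \<lparr>carrier = {c. c \<noteq> 0}, monoid.mult = (*), one = 1\<rparr>"

definition quasitorus :: "('g, 'm) monoid_scheme \<Rightarrow> ('g \<Rightarrow> 'k::field) set" where
  "quasitorus G = hom G mult_group"

definition orbit_of ::
  "nat \<Rightarrow> ('g, 'm) monoid_scheme \<Rightarrow> (nat \<Rightarrow> 'g) \<Rightarrow> (nat \<Rightarrow> 'k::field) \<Rightarrow> (nat \<Rightarrow> 'k) set" where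
  "orbit_of n G \<omega> x = (\<lambda>h. \<lambda>i\<in>{0..n}. h (\<omega> i) * x i) ` quasitorus G"

text \<open>The fake weighted projective space \<open>Z\<close>, its Zariski topology and its regular functions.\<close>

definition fwps ::
  "nat \<Rightarrow> ('g, 'm) monoid_scheme \<Rightarrow> (nat \<Rightarrow> 'g) \<Rightarrow> (nat \<Rightarrow> 'k::field) set set" where
  "fwps n G \<omega> = orbit_of n G \<omega> ` punctured_space n"

definition preimage ::
  "nat \<Rightarrow> ('g, 'm) monoid_scheme \<Rightarrow> (nat \<Rightarrow> 'g) \<Rightarrow> (nat \<Rightarrow> 'k::field) set set \<Rightarrow> (nat \<Rightarrow> 'k) set" where
  "preimage n G \<omega> U = {x \<in> punctured_space n. orbit_of n G \<omega> x \<in> U}"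

definition fwps_open ::
  "nat \<Rightarrow> ('g, 'm) monoid_scheme \<Rightarrow> (nat \<Rightarrow> 'g) \<Rightarrow> (nat \<Rightarrow> 'k::field) set set \<Rightarrow> bool" where
  "fwps_open n G \<omega> U \<longleftrightarrow> U \<subseteq> fwps n G \<omega> \<and> zariski_open n (preimage n G \<omega> U)"

definition fwps_regular ::
  "nat \<Rightarrow> ('g, 'm) monoid_scheme \<Rightarrow> (nat \<Rightarrow> 'g) \<Rightarrow> (nat \<Rightarrow> 'k::field) set set \<Rightarrow>
   ((nat \<Rightarrow> 'k) set \<Rightarrow> 'k) \<Rightarrow> bool" where
  "fwps_regular n G \<omega> U f \<longleftrightarrow> regular n (preimage n G \<omega> U) (\<lambda>x. f (orbit_of n G \<omega> x))"


section \<open>Cartier divisors and nef-partitions\<close>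

text \<open>The torus-invariant Weil divisor \<open>D = a\<^sub>0 D\<^sub>0 + \<dots> + a\<^sub>n D\<^sub>n\<close>, where \<open>D\<^sub>i\<close> is the image of
  \<open>{x\<^sub>i = 0}\<close>, is principal on the open set \<open>U\<close>: some rational function \<open>f\<close> on \<open>Z\<close> (regular on a
  nonempty open set \<open>W\<close>) has divisor \<open>D\<close> on \<open>U\<close>.  The quasitorus acts freely outside a set of
  codimension two, so divisors can be compared after pulling back to the punctured space.  The
  pullback of \<open>D\<close> is the divisor of the Laurent monomial with exponents \<open>a\<^sub>i\<close>; hence the pullback
  of \<open>f\<close> has to be this monomial times an invertible regular function \<open>u\<close>.\<close>

definition principal_on ::
  "'k::field itself \<Rightarrow> nat \<Rightarrow> ('g, 'm) monoid_scheme \<Rightarrow> (nat \<Rightarrow> 'g) \<Rightarrow> (nat \<Rightarrow> int) \<Rightarrow>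
   (nat \<Rightarrow> 'k) set set \<Rightarrow> bool" where
  "principal_on K n G \<omega> a U \<longleftrightarrow>
     (\<exists>W f u. fwps_open n G \<omega> W \<and> W \<noteq> {} \<and> fwps_regular n G \<omega> W f \<and>
        regular n (preimage n G \<omega> U) u \<and> (\<forall>y\<in>preimage n G \<omega> U. u y \<noteq> 0) \<and>
        (\<forall>y \<in> preimage n G \<omega> (U \<inter> W) \<inter> torus n.
           f (orbit_of n G \<omega> y) = (\<Prod>i\<in>{0..n}. y i powi a i) * u y))"

definition cartier ::
  "'k::field itself \<Rightarrow> nat \<Rightarrow> ('g, 'm) monoid_scheme \<Rightarrow> (nat \<Rightarrow> 'g) \<Rightarrow> (nat \<Rightarrow> int) \<Rightarrow> bool" where
  "cartier K n G \<omega> a \<longleftrightarrow>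
     (\<forall>z \<in> (fwps n G \<omega> :: (nat \<Rightarrow> 'k) set set).
        \<exists>U. fwps_open n G \<omega> U \<and> z \<in> U \<and> principal_on K n G \<omega> a U)"

text \<open>Every divisor class contains torus-invariant divisors, the class of \<open>D\<^sub>i\<close> being \<open>\<omega>\<^sub>i\<close>, and being
  Cartier depends only on the class.\<close>

definition Pic ::
  "'k::field itself \<Rightarrow> nat \<Rightarrow> ('g, 'm) monoid_scheme \<Rightarrow> (nat \<Rightarrow> 'g) \<Rightarrow> 'g set" where
  "Pic K n G \<omega> =
     {(\<Otimes>\<^bsub>G\<^esub>i\<in>{0..n}. \<omega> i [^]\<^bsub>G\<^esub> a i) | a :: nat \<Rightarrow> int. cartier K n G \<omega> a}"

definition block_class :: "('g, 'm) monoid_scheme \<Rightarrow> (nat \<Rightarrow> 'g) \<Rightarrow> nat set \<Rightarrow> 'g" where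
  "block_class G \<omega> B = (\<Otimes>\<^bsub>G\<^esub>i\<in>B. \<omega> i)"

definition index_partition :: "nat \<Rightarrow> nat \<Rightarrow> (nat \<Rightarrow> nat set) \<Rightarrow> bool" where
  "index_partition n s p \<longleftrightarrow>
     (\<Union>j\<in>{1..s}. p j) = {0..n} \<and> disjoint_family_on p {1..s} \<and> (\<forall>j\<in>{1..s}. p j \<noteq> {})"

definition nef_partition ::
  "'k::field itself \<Rightarrow> nat \<Rightarrow> ('g, 'm) monoid_scheme \<Rightarrow> (nat \<Rightarrow> 'g) \<Rightarrow> nat \<Rightarrow> (nat \<Rightarrow> nat set) \<Rightarrow> bool"
  where
  "nef_partition K n G \<omega> s p \<longleftrightarrow>
     index_partition n s p \<and>
     (\<forall>j\<in>{1..s}. block_class G \<omega> (p j) \<in> Pic K n G \<omega>) \<and>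
     (\<forall>j\<in>{1..s}. \<forall>i\<in>{0..n}. block_class G \<omega> (p j) \<noteq> \<omega> i)"

end

theory Submission
  imports Defs
begin

text \<open>
A block of a partition satisfies the Picard condition if and only if its class lies in \<open>Pic(Z)\<close>,
and the whole proof rests on the description
\<open>Pic(Z) = \<langle>\<omega>\<^sub>0\<rangle> \<inter> \<dots> \<inter> \<langle>\<omega>\<^sub>n\<rangle>\<close>, as a subgroup of \<open>Cl(Z)\<close> (\<open>Pic_eq_Inter_generate\<close>).

The inclusion from right to left (\<open>cartier_if_divisor_class_in_generate\<close>) holds because a class
\<open>c \<cdot> \<omega>\<^sub>i\<close> becomes trivial on the affine chart \<open>{x\<^sub>i \<noteq> 0}\<close>, where \<open>x\<^sub>i\<^sup>c\<close> is a unit of this degree.  For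
the other one (\<open>divisor_class_in_generate_if_cartier\<close>), a local equation at the \<open>i\<close>-th coordinate
point produces a unit \<open>u\<close> on which the quasitorus acts through the inverse of the class \<open>\<kappa>\<close>.
Evaluating \<open>u\<close> at the coordinate point shows that \<open>\<kappa>\<close> is trivial on the stabilizer of this point,
which consists of the characters of \<open>Cl(Z)\<close> that are trivial on \<open>\<omega>\<^sub>i\<close>.  Over an algebraically closed
field of characteristic zero there are enough characters to conclude \<open>\<kappa> \<in> \<langle>\<omega>\<^sub>i\<rangle>\<close>
(\<open>characters_separate\<close>).

What remains is arithmetic (\<open>Inter_generate_degrees_iff\<close>).  An element \<open>(d, \<zeta>)\<close> of the intersection
has \<open>L\<close> dividing \<open>d\<close> and equals \<open>(d / L) (L / w\<^sub>i) \<cdot> \<omega>\<^sub>i\<close> for each \<open>i\<close>.  Since the \<open>\<omega>\<^sub>i\<close> generate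
\<open>Cl(Z)\<close>, its torsion part \<open>\<zeta>\<close> has to vanish (\<open>common_power_torsion_free\<close>), and then the equations
in the torsion coordinates say that \<open>M\<^sub>k\<close> divides \<open>d / L\<close>.
\<close>

section \<open>Characters of finitely generated abelian groups\<close>

lemma hom_finprod:
  assumes "comm_group G" "comm_group H" "h \<in> hom G H" "finite A" "f \<in> A \<rightarrow> carrier G"
  shows "h (finprod G f A) = finprod H (\<lambda>i. h (f i)) A"
proof -
  interpret G: comm_group G by fact
  interpret H: comm_group H by fact
  interpret group_hom G H h
    using assms(3) by (simp add: group_hom_def group_hom_axioms_def)
  show ?thesis using assms(4,5)
  proof (induction A)
    case (insert x A)
    then have "f x \<in> carrier G" "f \<in> A \<rightarrow> carrier G" by auto
    moreover from this have "h (f x) \<in> carrier H" "(\<lambda>i. h (f i)) \<in> A \<rightarrow> carrier H"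
      using hom_closed by blast+
    ultimately show ?case using insert by (simp add: G.finprod_insert H.finprod_insert)
  qed simp
qed

lemma comm_group_mult_group: "comm_group (mult_group :: 'k::field monoid)"
proof (rule comm_groupI)
  fix x :: 'k assume "x \<in> carrier mult_group"
  then show "\<exists>y\<in>carrier mult_group. y \<otimes>\<^bsub>mult_group\<^esub> x = \<one>\<^bsub>mult_group\<^esub>"
    by (intro bexI[of _ "inverse x"]) (auto simp: mult_group_def)
qed (auto simp: mult_group_def)

lemma int_pow_mult_group:
  fixes c :: "'k::field"
  assumes "c \<noteq> 0"
  shows "c [^]\<^bsub>mult_group\<^esub> (m::int) = c powi m"
proof -
  interpret comm_group "mult_group :: 'k monoid" by (rule comm_group_mult_group)
  have pow: "c [^]\<^bsub>mult_group\<^esub> (k::nat) = c ^ k" for k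
    by (induction k) (simp_all add: mult_group_def)
  have inv: "inv\<^bsub>mult_group\<^esub> (c ^ k) = inverse (c ^ k)" for k
    using assms by (intro inv_equality) (auto simp: mult_group_def)
  show ?thesis by (auto simp: int_pow_def2 power_int_def pow inv power_inverse)
qed

lemma finprod_mult_group:
  fixes f :: "'a \<Rightarrow> 'k::field"
  assumes "finite A" "\<And>i. i \<in> A \<Longrightarrow> f i \<noteq> 0"
  shows "finprod mult_group f A = prod f A"
proof -
  interpret comm_group "mult_group :: 'k monoid" by (rule comm_group_mult_group)
  show ?thesis using assms
  proof (induction A)
    case empty then show ?case by simp (simp add: mult_group_def)
  next
    case (insert x A)
    then have "f \<in> A \<rightarrow> carrier mult_group" "f x \<in> carrier mult_group"
      by (auto simp: mult_group_def)
    then have "finprod mult_group f (insert x A) = f x \<otimes>\<^bsub>mult_group\<^esub> finprod mult_group f A"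
      using insert by (simp add: finprod_insert)
    then show ?case using insert by (simp add: mult_group_def)
  qed
qed

text \<open>Both hypotheses on the field enter here: algebraic closedness gives a root of
\<open>1 + z + \<dots> + z\<^sup>d\<^sup>-\<^sup>1\<close>, and this root differs from \<open>1\<close> because the sum has the value \<open>d \<noteq> 0\<close> at \<open>1\<close>.\<close>

lemma nontrivial_root_of_unity:
  assumes "2 \<le> d"
  obtains z :: "'k::{alg_closed_field,field_char_0}" where "z ^ d = 1" "z \<noteq> 1"
proof -
  have "\<exists>z::'k. (\<Sum>k\<le>d-1. 1 * z ^ k) = 0"
    by (rule alg_closed) (use assms in auto)
  then obtain z :: 'k where z: "(\<Sum>k\<le>d-1. z ^ k) = 0" by auto
  have "{..d-1} = {..<d}" using assms by auto
  then have *: "(\<Sum>k<d. z ^ k) = 0" using z by simp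
  have "z \<noteq> 1" using * assms by auto
  moreover have "z ^ d = 1" using * power_diff_1_eq[of z d] by simp
  ultimately show ?thesis using that by blast
qed

text \<open>This provides the value of a character at an element some power of which lies in its domain, and
lets that value be nontrivial.\<close>

lemma nth_root_avoiding_one:
  fixes a :: "'k::{alg_closed_field,field_char_0}"
  assumes "2 \<le> d"
  obtains c where "c ^ d = a" "c \<noteq> 1"
proof -
  obtain c where c: "c ^ d = a" using nth_root_exists[of d a] assms by auto
  obtain z :: 'k where "z ^ d = 1" "z \<noteq> 1" by (rule nontrivial_root_of_unity[OF assms])
  then show ?thesis using that c by (cases "c = 1") auto
qed

context comm_group
begin

text \<open>On the subgroup generated by \<open>S\<close> and \<open>g\<close>, an extension of \<open>\<chi>\<close> with \<open>\<chi>' g = c\<close> can only be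
\<open>s g\<^sup>m \<mapsto> \<chi> s \<cdot> c\<^sup>m\<close>.  An element may be written as \<open>s g\<^sup>m\<close> in several ways; two such ways differ by
a power of \<open>g\<close> that lies in \<open>S\<close>, so the compatibility hypothesis is what makes this well defined.\<close>

lemma extend_character_with_value:
  fixes \<chi> :: "'a \<Rightarrow> 'k::field"
  assumes S: "subgroup S G" and \<chi>: "\<chi> \<in> hom (G\<lparr>carrier := S\<rparr>) mult_group"
    and g: "g \<in> carrier G" and c: "c \<noteq> 0"
    and compat: "\<And>m::int. g [^] m \<in> S \<Longrightarrow> \<chi> (g [^] m) = c powi m"
  obtains S' \<chi>' where "subgroup S' G" "S \<subseteq> S'" "g \<in> S'"
    "\<chi>' \<in> hom (G\<lparr>carrier := S'\<rparr>) mult_group" "\<And>x. x \<in> S \<Longrightarrow> \<chi>' x = \<chi> x" "\<chi>' g = c"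
proof -
  interpret S: subgroup S G by (fact S)
  have \<chi>_mult: "\<chi> (x \<otimes> y) = \<chi> x * \<chi> y" if "x \<in> S" "y \<in> S" for x y
    using hom_mult[OF \<chi>, of x y] that by (simp add: mult_group_def)
  have \<chi>_nz: "\<chi> x \<noteq> 0" if "x \<in> S" for x
    using hom_in_carrier[OF \<chi>, of x] that by (simp add: mult_group_def)
  have \<chi>_one: "\<chi> \<one> = 1"
    using \<chi>_mult[of \<one> \<one>] \<chi>_nz[of \<one>] by simp
  define S' where "S' = {s \<otimes> g [^] (m::int) | s m. s \<in> S}"
  define \<chi>' where "\<chi>' x = (let (s, m) = (SOME (s, m::int). s \<in> S \<and> x = s \<otimes> g [^] m)
                           in \<chi> s * c powi m)" for x
  have wd: "\<chi> s * c powi m = \<chi> t * c powi l"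
    if "s \<in> S" "t \<in> S" "s \<otimes> g [^] m = t \<otimes> g [^] l" for s t and m l :: int
  proof -
    have sc: "s \<in> carrier G" "t \<in> carrier G" using that by auto
    have "g [^] (m - l) = g [^] m \<otimes> inv (g [^] l)"
      using g by (simp add: int_pow_diff)
    also have "\<dots> = inv s \<otimes> (s \<otimes> g [^] m) \<otimes> inv (g [^] l)"
      using sc g by (simp add: m_assoc[symmetric])
    also have "\<dots> = inv s \<otimes> t"
      using sc g that(3) by (simp add: m_assoc)
    finally have eq: "g [^] (m - l) = inv s \<otimes> t" .
    then have inS: "g [^] (m - l) \<in> S" using that by simp
    have "t = s \<otimes> g [^] (m - l)" using eq sc by (simp add: m_assoc[symmetric])
    then have "\<chi> t = \<chi> s * c powi (m - l)"
      using \<chi>_mult that inS compat by metis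
    then show ?thesis using c by (simp add: power_int_diff)
  qed
  have \<chi>': "\<chi>' (s \<otimes> g [^] m) = \<chi> s * c powi m" if "s \<in> S" for s and m :: int
  proof -
    define q where "q = (SOME (s', m'::int). s' \<in> S \<and> s \<otimes> g [^] m = s' \<otimes> g [^] m')"
    have "case q of (s', m') \<Rightarrow> s' \<in> S \<and> s \<otimes> g [^] m = s' \<otimes> g [^] m'"
      unfolding q_def by (rule someI[of _ "(s, m)"]) (use that in auto)
    then show ?thesis
      using wd[OF that] unfolding \<chi>'_def q_def[symmetric] by (auto split: prod.splits)
  qed
  have mult: "(s \<otimes> g [^] m) \<otimes> (t \<otimes> g [^] l) = (s \<otimes> t) \<otimes> g [^] (m + l)"
    if "s \<in> S" "t \<in> S" for s t and m l :: int
    using that g by (simp add: int_pow_mult m_ac)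
  have "subgroup S' G"
  proof (rule subgroupI)
    show "S' \<subseteq> carrier G" using g by (auto simp: S'_def)
    show "S' \<noteq> {}" using S.one_closed unfolding S'_def by blast
  next
    fix a assume "a \<in> S'"
    then obtain s and m :: int where a: "s \<in> S" "a = s \<otimes> g [^] m" by (auto simp: S'_def)
    then have "inv a = inv s \<otimes> g [^] (- m)" using g by (simp add: inv_mult int_pow_neg)
    then show "inv a \<in> S'" using a by (auto simp: S'_def)
  next
    fix a b assume "a \<in> S'" "b \<in> S'"
    then obtain s t and m l :: int where
      "s \<in> S" "a = s \<otimes> g [^] m" "t \<in> S" "b = t \<otimes> g [^] l" by (auto simp: S'_def)
    then show "a \<otimes> b \<in> S'" using mult by (auto simp: S'_def)
  qed
  moreover have "s = s \<otimes> g [^] (0::int)" if "s \<in> S" for s using that by simp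
  then have "S \<subseteq> S'" unfolding S'_def by blast
  moreover have g_eq: "g = \<one> \<otimes> g [^] (1::int)" using g by simp
  then have "g \<in> S'" using S.one_closed unfolding S'_def by blast
  moreover have "\<chi>' \<in> hom (G\<lparr>carrier := S'\<rparr>) mult_group"
  proof (rule homI)
    fix x assume "x \<in> carrier (G\<lparr>carrier := S'\<rparr>)"
    then show "\<chi>' x \<in> carrier mult_group"
      using \<chi>' \<chi>_nz c by (auto simp: S'_def mult_group_def)
  next
    fix x y assume "x \<in> carrier (G\<lparr>carrier := S'\<rparr>)" "y \<in> carrier (G\<lparr>carrier := S'\<rparr>)"
    then obtain s t and m l :: int where
      "s \<in> S" "x = s \<otimes> g [^] m" "t \<in> S" "y = t \<otimes> g [^] l" by (auto simp: S'_def)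
    then show "\<chi>' (x \<otimes>\<^bsub>G\<lparr>carrier := S'\<rparr>\<^esub> y) = \<chi>' x \<otimes>\<^bsub>mult_group\<^esub> \<chi>' y"
      using c by (simp add: mult \<chi>' \<chi>_mult power_int_add) (simp add: mult_group_def)
  qed
  moreover have "\<chi>' x = \<chi> x" if "x \<in> S" for x
    using \<chi>'[OF that, of 0] that by simp
  moreover have "\<chi>' g = c"
    using \<chi>'[of \<one> 1] g \<chi>_one by simp
  ultimately show ?thesis using that by blast
qed

text \<open>The exponents \<open>m\<close> with \<open>g\<^sup>m \<in> S\<close> are the multiples of some \<open>d\<close>.  If \<open>d = 0\<close>, every nonzero value at
\<open>g\<close> is compatible with \<open>\<chi>\<close>; if \<open>d > 0\<close>, the compatible values are the \<open>d\<close>-th roots of \<open>\<chi> (g\<^sup>d)\<close>.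
If \<open>g \<notin> S\<close>, then \<open>d \<noteq> 1\<close>, which leaves room for a value different from \<open>1\<close>.\<close>

lemma extend_character_by_element:
  fixes \<chi> :: "'a \<Rightarrow> 'k::{alg_closed_field,field_char_0}"
  assumes S: "subgroup S G" and \<chi>: "\<chi> \<in> hom (G\<lparr>carrier := S\<rparr>) mult_group"
    and g: "g \<in> carrier G"
  obtains S' \<chi>' where "subgroup S' G" "S \<subseteq> S'" "g \<in> S'"
    "\<chi>' \<in> hom (G\<lparr>carrier := S'\<rparr>) mult_group" "\<And>x. x \<in> S \<Longrightarrow> \<chi>' x = \<chi> x"
    "g \<notin> S \<Longrightarrow> \<chi>' g \<noteq> 1"
proof -
  interpret S: subgroup S G by (fact S)
  interpret hom: group_hom "G\<lparr>carrier := S\<rparr>" mult_group \<chi>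
    using \<chi> S.subgroup_is_group[OF is_group] comm_group.axioms(2)[OF comm_group_mult_group]
    by (simp add: group_hom_def group_hom_axioms_def)
  have \<chi>_nz: "\<chi> x \<noteq> 0" if "x \<in> S" for x
    using hom.hom_closed[of x] that by (simp add: mult_group_def)
  have "\<exists>c. c \<noteq> 0 \<and> (g \<notin> S \<longrightarrow> c \<noteq> 1) \<and> (\<forall>m::int. g [^] m \<in> S \<longrightarrow> \<chi> (g [^] m) = c powi m)"
  proof (cases "\<exists>m::nat. m > 0 \<and> g [^] m \<in> S")
    case False
    have "m = 0" if "g [^] m \<in> S" for m :: int
    proof -
      have "g [^] (-m) \<in> S" using that g by (simp add: int_pow_neg)
      moreover obtain k where "m = int k \<or> m = - int k" by (metis int_cases2)
      ultimately have "g [^] k \<in> S" using that by (auto simp: int_pow_int)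
      then show ?thesis using False \<open>m = int k \<or> m = - int k\<close> by auto
    qed
    moreover have "\<chi> \<one> = 1" using hom.hom_one by (simp add: mult_group_def)
    \<comment> \<open>In characteristic zero, \<open>2\<close> is neither \<open>0\<close> nor \<open>1\<close>.\<close>
    ultimately show ?thesis by (intro exI[of _ 2]) (force)
  next
    case True
    define d where "d = (LEAST m::nat. m > 0 \<and> g [^] m \<in> S)"
    have d: "d > 0" "g [^] d \<in> S"
      using LeastI_ex[OF True] by (simp_all add: d_def)
    have d_least: "d \<le> m" if "m > 0" "g [^] m \<in> S" for m :: nat
      unfolding d_def by (rule Least_le) (use that in auto)
    obtain c where c: "c ^ d = \<chi> (g [^] d)" "g \<notin> S \<longrightarrow> c \<noteq> 1"
    proof (cases "d = 1")
      case True
      then show ?thesis using that[of "\<chi> (g [^] d)"] d g by simp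
    next
      case False
      then have "2 \<le> d" using d by simp
      then show ?thesis using that by (metis nth_root_avoiding_one)
    qed
    have "c \<noteq> 0" using c(1) d(1) \<chi>_nz[OF d(2)] by (metis gr_implies_not0 power_0_left)
    moreover have "\<chi> (g [^] m) = c powi m" if "g [^] m \<in> S" for m :: int
    proof -
      define q r where "q = m div int d" and "r = m mod int d"
      have m: "m = int d * q + r" and r: "0 \<le> r" "r < int d"
        using d by (simp_all add: q_def r_def)
      have gq: "g [^] (int d * q) = (g [^] d) [^] q"
        using g by (simp add: int_pow_pow[symmetric] int_pow_int)
      have in_S: "(g [^] d) [^] q \<in> S"
        using d by (simp add: subgroup_int_pow_closed S)
      have "g [^] r = inv (g [^] (int d * q)) \<otimes> g [^] m"
        using g by (simp add: m int_pow_mult m_assoc[symmetric])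
      then have "g [^] r \<in> S" using that gq in_S by simp
      then have "g [^] nat r \<in> S" using r(1) by (metis int_nat_eq int_pow_int)
      then have "r = 0" using d_least[of "nat r"] r by force
      then have "\<chi> (g [^] m) = \<chi> ((g [^] d) [^] q)" using m gq by simp
      also have "\<dots> = \<chi> ((g [^] d) [^]\<^bsub>G\<lparr>carrier := S\<rparr>\<^esub> q)"
        using int_pow_consistent[OF S d(2)] by simp
      also have "\<dots> = \<chi> (g [^] d) powi q"
        using hom.hom_int_pow[of "g [^] d" q] d(2) \<chi>_nz by (simp add: int_pow_mult_group)
      also have "\<dots> = c powi m"
        using \<open>r = 0\<close> m by (simp add: power_int_mult flip: c(1))
      finally show ?thesis .
    qed
    ultimately show ?thesis using c by blast
  qed
  then obtain c where "c \<noteq> 0" "g \<notin> S \<Longrightarrow> c \<noteq> 1"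
    "\<And>m::int. g [^] m \<in> S \<Longrightarrow> \<chi> (g [^] m) = c powi m" by blast
  then show ?thesis
    using extend_character_with_value[OF S \<chi> g, of c thesis] that by blast
qed

lemma extend_character_by_finite_set:
  fixes \<chi> :: "'a \<Rightarrow> 'k::{alg_closed_field,field_char_0}"
  assumes "finite A" "A \<subseteq> carrier G"
    and "subgroup S G" "\<chi> \<in> hom (G\<lparr>carrier := S\<rparr>) mult_group"
  shows "\<exists>S' \<chi>'. subgroup S' G \<and> S \<union> A \<subseteq> S' \<and> \<chi>' \<in> hom (G\<lparr>carrier := S'\<rparr>) mult_group \<and>
    (\<forall>x\<in>S. \<chi>' x = \<chi> x)"
  using assms(1,2)
proof (induction A)
  case empty
  then show ?case using assms by blast
next
  case (insert g A)
  then obtain S1 \<chi>1 where 1: "subgroup S1 G" "S \<union> A \<subseteq> S1"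
    "\<chi>1 \<in> hom (G\<lparr>carrier := S1\<rparr>) (mult_group :: 'k monoid)" "\<forall>x\<in>S. \<chi>1 x = \<chi> x" by auto
  have "g \<in> carrier G" using insert by simp
  from extend_character_by_element[OF 1(1,3) this] obtain S2 \<chi>2 where
    "subgroup S2 G" "S1 \<subseteq> S2" "g \<in> S2"
    "\<chi>2 \<in> hom (G\<lparr>carrier := S2\<rparr>) (mult_group :: 'k monoid)" "\<And>x. x \<in> S1 \<Longrightarrow> \<chi>2 x = \<chi>1 x" by metis
  then show ?case using 1 by (intro exI[of _ S2] exI[of _ \<chi>2]) auto
qed

text \<open>The trivial character of \<open>S\<close> extends to \<open>\<langle>S, g\<rangle>\<close> with a nontrivial value at \<open>g\<close>, and from there,
one generator at a time, to the whole group.\<close>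

lemma characters_separate:
  assumes "finite A" "generate G A = carrier G" "subgroup S G" "g \<in> carrier G" "g \<notin> S"
  obtains h :: "'a \<Rightarrow> 'k::{alg_closed_field,field_char_0}"
  where "h \<in> quasitorus G" "\<And>x. x \<in> S \<Longrightarrow> h x = 1" "h g \<noteq> 1"
proof -
  have A: "A \<subseteq> carrier G" using assms(2) generate.incl by fastforce
  have "(\<lambda>_. 1) \<in> hom (G\<lparr>carrier := S\<rparr>) (mult_group :: 'k monoid)"
    by (rule homI) (auto simp: mult_group_def)
  from extend_character_by_element[OF assms(3) this assms(4)] obtain S1 \<chi>1 where 1:
    "subgroup S1 G" "S \<subseteq> S1" "g \<in> S1" "\<chi>1 \<in> hom (G\<lparr>carrier := S1\<rparr>) (mult_group :: 'k monoid)"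
    "\<And>x. x \<in> S \<Longrightarrow> \<chi>1 x = 1" "\<chi>1 g \<noteq> 1" using assms(5) by metis
  from extend_character_by_finite_set[OF assms(1) A 1(1,4)] obtain S2 \<chi>2 where 2:
    "subgroup S2 G" "S1 \<union> A \<subseteq> S2" "\<chi>2 \<in> hom (G\<lparr>carrier := S2\<rparr>) (mult_group :: 'k monoid)"
    "\<forall>x\<in>S1. \<chi>2 x = \<chi>1 x" by blast
  have "S2 = carrier G"
    using generate_subgroup_incl[of A S2] 2 assms(2) subgroup.subset by blast
  then have "\<chi>2 \<in> quasitorus G" using 2(3) by (simp add: quasitorus_def)
  moreover have "\<chi>2 x = 1" if "x \<in> S" for x using that 1(2,5) 2(4) by auto
  moreover have "\<chi>2 g \<noteq> 1" using 1(3,6) 2(4) by auto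
  ultimately show ?thesis by (rule that)
qed

end

section \<open>Polynomial functions and regular functions\<close>

lemma polynomial_functions_prod:
  assumes "finite A" "\<And>i. i \<in> A \<Longrightarrow> f i \<in> polynomial_functions n"
  shows "(\<lambda>x. \<Prod>i\<in>A. f i x) \<in> polynomial_functions n"
  using assms
  by (induction A) (auto intro: polynomial_functions.intros)

lemma polynomial_functions_power:
  "f \<in> polynomial_functions n \<Longrightarrow> (\<lambda>x. f x ^ m) \<in> polynomial_functions n"
  by (induction m) (auto intro: polynomial_functions.intros)

lemma polynomial_functions_diff:
  assumes "f \<in> polynomial_functions n" "g \<in> polynomial_functions n"
  shows "(\<lambda>x. f x - g x) \<in> polynomial_functions n"
proof -
  have "(\<lambda>x. f x + (- 1) * g x) \<in> polynomial_functions n"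
    by (intro polynomial_functions.intros assms)
  then show ?thesis by simp
qed

definition act :: "nat \<Rightarrow> (nat \<Rightarrow> 'g) \<Rightarrow> ('g \<Rightarrow> 'k::field) \<Rightarrow> (nat \<Rightarrow> 'k) \<Rightarrow> (nat \<Rightarrow> 'k)" where
  "act n \<omega> h x = (\<lambda>i\<in>{0..n}. h (\<omega> i) * x i)"

lemma polynomial_functions_act:
  assumes "f \<in> polynomial_functions n"
  shows "(\<lambda>x. f (act n \<omega> h x)) \<in> polynomial_functions n"
  using assms
  by (induction) (auto simp: act_def intro: polynomial_functions.intros)

lemma polynomial_functions_line:
  assumes "f \<in> polynomial_functions n"
  shows "\<exists>P. \<forall>t. f (\<lambda>i\<in>{0..n}. a i + t * (b i - a i)) = poly P t"
  using assms
proof induction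
  case (const c)
  then show ?case by (intro exI[of _ "[:c:]"]) simp
next
  case (coord i)
  then show ?case by (intro exI[of _ "[:a i, b i - a i:]"]) simp
next
  case (add f g)
  then obtain P Q where "\<forall>t. f (\<lambda>i\<in>{0..n}. a i + t * (b i - a i)) = poly P t"
    "\<forall>t. g (\<lambda>i\<in>{0..n}. a i + t * (b i - a i)) = poly Q t" by blast
  then show ?case by (intro exI[of _ "P + Q"]) (simp only: poly_add simp_thms)
next
  case (mult f g)
  then obtain P Q where "\<forall>t. f (\<lambda>i\<in>{0..n}. a i + t * (b i - a i)) = poly P t"
    "\<forall>t. g (\<lambda>i\<in>{0..n}. a i + t * (b i - a i)) = poly Q t" by blast
  then show ?case by (intro exI[of _ "P * Q"]) (simp only: poly_mult simp_thms)
qed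

text \<open>This says that affine space is irreducible: two nonempty open sets meet.  On the line through \<open>a\<close>
and \<open>b\<close>, both functions become nonzero polynomials in one variable, and their product has only
finitely many zeros in an infinite field.\<close>

lemma polynomial_functions_common_nonzero:
  fixes f g :: "(nat \<Rightarrow> 'k::field_char_0) \<Rightarrow> 'k"
  assumes "f \<in> polynomial_functions n" "g \<in> polynomial_functions n"
    and "a \<in> {0..n} \<rightarrow>\<^sub>E UNIV" "f a \<noteq> 0" "b \<in> {0..n} \<rightarrow>\<^sub>E UNIV" "g b \<noteq> 0"
  obtains y where "y \<in> {0..n} \<rightarrow>\<^sub>E UNIV" "f y \<noteq> 0" "g y \<noteq> 0"
proof -
  define l where "l t = (\<lambda>i\<in>{0..n}. a i + t * (b i - a i))" for t
  obtain P where P: "\<And>t. f (l t) = poly P t"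
    using polynomial_functions_line[OF assms(1), of a b] unfolding l_def by blast
  obtain Q where Q: "\<And>t. g (l t) = poly Q t"
    using polynomial_functions_line[OF assms(2), of a b] unfolding l_def by blast
  have "l 0 = a" "l 1 = b"
    using assms(3,5) by (simp_all add: l_def PiE_restrict)
  then have "P \<noteq> 0" "Q \<noteq> 0" using P[of 0] Q[of 1] assms(4,6) by auto
  then have "finite {t. poly (P * Q) t = 0}" by (intro poly_roots_finite) simp
  then obtain t where "poly (P * Q) t \<noteq> 0"
    using infinite_UNIV_char_0[where 'a='k] by (metis (mono_tags) UNIV_eq_I mem_Collect_eq)
  then show ?thesis using that[of "l t"] P Q by (simp add: l_def)
qed

lemma torus_subset: "torus n \<subseteq> punctured_space n"
  by (auto simp: torus_def punctured_space_def)

lemma zariski_open_nonvanishing: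
  "f \<in> polynomial_functions n \<Longrightarrow> zariski_open n {x \<in> punctured_space n. f x \<noteq> 0}"
  unfolding zariski_open_def by (intro exI[of _ "{f}"]) auto

lemma zariski_open_torus: "zariski_open n (torus n)"
proof -
  have "(\<lambda>x::nat \<Rightarrow> 'a. \<Prod>i\<in>{0..n}. x i) \<in> polynomial_functions n"
    by (intro polynomial_functions_prod polynomial_functions.coord) auto
  moreover have "torus n = {x::nat \<Rightarrow> 'a. x \<in> punctured_space n \<and> (\<Prod>i\<in>{0..n}. x i) \<noteq> 0}"
    by (auto simp: torus_def punctured_space_def)
  ultimately show ?thesis using zariski_open_nonvanishing by metis
qed

definition laurent_monomial :: "nat \<Rightarrow> (nat \<Rightarrow> int) \<Rightarrow> (nat \<Rightarrow> 'k::field) \<Rightarrow> 'k" where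
  "laurent_monomial n a y = (\<Prod>i\<in>{0..n}. y i powi a i)"

text \<open>The denominator collects the variables with negative exponents; the hypothesis keeps it away from
zero on \<open>V\<close>.\<close>

lemma regular_laurent_monomial:
  fixes V :: "(nat \<Rightarrow> 'k::field) set"
  assumes "zariski_open n V"
    and "\<And>y i. y \<in> V \<Longrightarrow> i \<le> n \<Longrightarrow> b i < 0 \<Longrightarrow> y i \<noteq> 0"
    and "\<And>y. y \<in> V \<Longrightarrow> u y = laurent_monomial n b y"
  shows "regular n V u"
proof -
  define g h :: "(nat \<Rightarrow> 'k) \<Rightarrow> 'k" where
    "g y = (\<Prod>i\<in>{0..n}. y i ^ nat (b i))" and "h y = (\<Prod>i\<in>{0..n}. y i ^ nat (- b i))" for y
  have "g \<in> polynomial_functions n" "h \<in> polynomial_functions n" unfolding g_def h_def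
    by (intro polynomial_functions_prod polynomial_functions_power polynomial_functions.coord; simp)+
  moreover have "h y \<noteq> 0" if "y \<in> V" for y
    using assms(2)[OF that] by (force simp: h_def)
  moreover have "laurent_monomial n b y = g y / h y" for y
    unfolding laurent_monomial_def g_def h_def prod_dividef[symmetric]
    by (intro prod.cong) (auto simp: power_int_def field_simps)
  ultimately show ?thesis
    using assms(1,3) unfolding regular_def by (metis subset_refl)
qed

section \<open>The action of the quasitorus\<close>

definition divisor_class :: "nat \<Rightarrow> ('g, 'm) monoid_scheme \<Rightarrow> (nat \<Rightarrow> 'g) \<Rightarrow> (nat \<Rightarrow> int) \<Rightarrow> 'g" where
  "divisor_class n G \<omega> a = (\<Otimes>\<^bsub>G\<^esub>i\<in>{0..n}. \<omega> i [^]\<^bsub>G\<^esub> a i)"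

text \<open>A polynomial ring in \<open>n + 1\<close> variables, graded by a finitely generated abelian group that is
generated by the degrees of the variables.\<close>

locale graded_coordinates = comm_group G for G :: "('g, 'm) monoid_scheme" (structure) +
  fixes n :: nat and \<omega> :: "nat \<Rightarrow> 'g"
  assumes degree_closed [simp]: "i \<le> n \<Longrightarrow> \<omega> i \<in> carrier G"
    and degrees_generate: "generate G (\<omega> ` {0..n}) = carrier G"
begin

lemma divisor_class_closed [simp]: "divisor_class n G \<omega> a \<in> carrier G"
  unfolding divisor_class_def by (rule finprod_closed) auto

lemma divisor_class_add:
  "divisor_class n G \<omega> (\<lambda>i. a i + b i) = divisor_class n G \<omega> a \<otimes> divisor_class n G \<omega> b"
proof -
  have "divisor_class n G \<omega> (\<lambda>i. a i + b i) = (\<Otimes>i\<in>{0..n}. \<omega> i [^] a i \<otimes> \<omega> i [^] b i)"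
    unfolding divisor_class_def by (rule finprod_cong) (auto simp: int_pow_mult simp_implies_def)
  then show ?thesis
    unfolding divisor_class_def by (simp add: finprod_multf degree_closed Pi_def)
qed

lemma divisor_class_single:
  assumes "i \<le> n"
  shows "divisor_class n G \<omega> (\<lambda>j. if j = i then c else 0) = \<omega> i [^] c"
proof -
  have "divisor_class n G \<omega> (\<lambda>j. if j = i then c else 0) =
      (\<Otimes>j\<in>{0..n}. if i = j then \<omega> j [^] c else \<one>)"
    unfolding divisor_class_def by (rule finprod_cong) (auto simp: simp_implies_def)
  also have "\<dots> = \<omega> i [^] c"
    by (rule finprod_singleton) (use assms in auto)
  finally show ?thesis .
qed

lemma quasitorus_nonzero: "h \<in> quasitorus G \<Longrightarrow> g \<in> carrier G \<Longrightarrow> h g \<noteq> 0"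
  unfolding quasitorus_def using hom_in_carrier by (fastforce simp: mult_group_def)

lemma quasitorus_int_pow:
  assumes "h \<in> quasitorus G" "g \<in> carrier G"
  shows "h (g [^] (m::int)) = h g powi m"
proof -
  have "h (g [^] m) = h g [^]\<^bsub>mult_group\<^esub> m"
    by (rule hom_int_pow) (use assms comm_group_mult_group in
      \<open>auto simp: quasitorus_def intro: comm_group.axioms(2)\<close>)
  then show ?thesis using quasitorus_nonzero[OF assms] by (simp add: int_pow_mult_group)
qed

lemma quasitorus_divisor_class:
  assumes "h \<in> quasitorus G"
  shows "h (divisor_class n G \<omega> a) = (\<Prod>i\<in>{0..n}. h (\<omega> i) powi a i)"
proof -
  have "h (divisor_class n G \<omega> a) = (\<Otimes>\<^bsub>mult_group\<^esub>i\<in>{0..n}. h (\<omega> i [^] a i))"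
    unfolding divisor_class_def using assms comm_group_mult_group comm_group_axioms
    by (intro hom_finprod) (auto simp: quasitorus_def)
  also have "\<dots> = (\<Prod>i\<in>{0..n}. h (\<omega> i [^] a i))"
    by (rule finprod_mult_group) (use assms in \<open>auto simp: quasitorus_nonzero\<close>)
  also have "\<dots> = (\<Prod>i\<in>{0..n}. h (\<omega> i) powi a i)"
    by (rule prod.cong) (use assms in \<open>auto intro: quasitorus_int_pow\<close>)
  finally show ?thesis .
qed

text \<open>A monomial is homogeneous: the quasitorus acts on it through the character given by its degree.\<close>

lemma laurent_monomial_act:
  assumes "h \<in> quasitorus G"
  shows "laurent_monomial n a (act n \<omega> h y) = h (divisor_class n G \<omega> a) * laurent_monomial n a y"
  by (simp add: laurent_monomial_def act_def quasitorus_divisor_class[OF assms]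
      power_int_mult_distrib prod.distrib)

lemma act_nonzero_iff:
  "h \<in> quasitorus G \<Longrightarrow> i \<le> n \<Longrightarrow> act n \<omega> h y i \<noteq> 0 \<longleftrightarrow> y i \<noteq> 0"
  using quasitorus_nonzero[of h "\<omega> i"] by (simp add: act_def degree_closed)

lemma act_extensional: "act n \<omega> h y \<in> {0..n} \<rightarrow>\<^sub>E UNIV"
  by (simp add: act_def)

lemma act_punctured: "h \<in> quasitorus G \<Longrightarrow> y \<in> punctured_space n \<Longrightarrow> act n \<omega> h y \<in> punctured_space n"
  using act_extensional[of h y] by (auto simp: punctured_space_def act_nonzero_iff)

lemma act_torus: "h \<in> quasitorus G \<Longrightarrow> y \<in> torus n \<Longrightarrow> act n \<omega> h y \<in> torus n"
  using act_extensional[of h y] by (auto simp: torus_def act_nonzero_iff)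

lemma orbit_of_eq: "orbit_of n G \<omega> x = (\<lambda>h. act n \<omega> h x) ` quasitorus G"
  by (simp add: orbit_of_def act_def)

lemma quasitorus_mult:
  "h \<in> quasitorus G \<Longrightarrow> h' \<in> quasitorus G \<Longrightarrow> (\<lambda>g. h g * h' g) \<in> quasitorus G"
  by (auto simp: quasitorus_def hom_def mult_group_def Pi_def)

lemma quasitorus_inverse: "h \<in> quasitorus G \<Longrightarrow> (\<lambda>g. inverse (h g)) \<in> quasitorus G"
  by (auto simp: quasitorus_def hom_def mult_group_def Pi_def)

lemma mem_orbit_of_self:
  assumes "x \<in> {0..n} \<rightarrow>\<^sub>E UNIV"
  shows "x \<in> orbit_of n G \<omega> x"
proof -
  have "(\<lambda>_. 1) \<in> quasitorus G" by (auto simp: quasitorus_def hom_def mult_group_def)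
  moreover have "x = act n \<omega> (\<lambda>_. 1) x" using assms by (simp add: act_def PiE_restrict)
  ultimately show ?thesis unfolding orbit_of_eq by blast
qed

lemma orbit_of_act:
  fixes h :: "'g \<Rightarrow> 'k::field"
  assumes h: "h \<in> quasitorus G"
  shows "orbit_of n G \<omega> (act n \<omega> h x) = orbit_of n G \<omega> x"
proof -
  have act_act: "act n \<omega> h' (act n \<omega> h x) = act n \<omega> (\<lambda>g. h' g * h g) x" for h' h :: "'g \<Rightarrow> 'k" and x
    by (auto simp: act_def)
  have le: "orbit_of n G \<omega> (act n \<omega> h x) \<subseteq> orbit_of n G \<omega> x"
    if "h \<in> quasitorus G" for h :: "'g \<Rightarrow> 'k" and x
    using quasitorus_mult[OF _ that] by (auto simp: orbit_of_eq act_act)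
  have "act n \<omega> h' x = act n \<omega> (\<lambda>g. h' g * inverse (h g)) (act n \<omega> h x)" for h'
    using quasitorus_nonzero[OF h] degree_closed by (auto simp: act_def)
  then have "orbit_of n G \<omega> x \<subseteq> orbit_of n G \<omega> (act n \<omega> h x)"
    using quasitorus_mult[OF _ quasitorus_inverse[OF h]] unfolding orbit_of_eq by blast
  with le[OF h] show ?thesis by blast
qed

lemma orbit_of_eqE:
  assumes "orbit_of n G \<omega> x = orbit_of n G \<omega> y" "x \<in> punctured_space n"
  obtains h where "h \<in> quasitorus G" "x = act n \<omega> h y"
  using mem_orbit_of_self[of x] assms unfolding punctured_space_def orbit_of_eq[of y] by auto

lemma preimage_orbits:
  assumes "V \<subseteq> punctured_space n"
    and "\<And>h y. h \<in> quasitorus G \<Longrightarrow> y \<in> V \<Longrightarrow> act n \<omega> h y \<in> V"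
  shows "preimage n G \<omega> (orbit_of n G \<omega> ` V) = V"
  using assms by (fastforce simp: preimage_def elim: orbit_of_eqE)

lemma fwps_open_orbits:
  assumes "zariski_open n V"
    and "\<And>h y. h \<in> quasitorus G \<Longrightarrow> y \<in> V \<Longrightarrow> act n \<omega> h y \<in> V"
  shows "fwps_open n G \<omega> (orbit_of n G \<omega> ` V)" "preimage n G \<omega> (orbit_of n G \<omega> ` V) = V"
proof -
  have V: "V \<subseteq> punctured_space n" using assms(1) by (auto simp: zariski_open_def)
  show "preimage n G \<omega> (orbit_of n G \<omega> ` V) = V" using V assms(2) by (rule preimage_orbits)
  then show "fwps_open n G \<omega> (orbit_of n G \<omega> ` V)"
    using V assms(1) by (auto simp: fwps_open_def fwps_def)
qed

section \<open>The Picard group\<close>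

text \<open>If the class of \<open>a\<close> is \<open>c \<cdot> \<omega>\<^sub>i\<close>, then \<open>y\<^sup>a / y\<^sub>i\<^sup>c\<close> has degree zero, hence is invariant and descends to
a rational function on the quotient.  It defines the divisor on \<open>{y\<^sub>i \<noteq> 0}\<close>, where \<open>y\<^sub>i\<^sup>-\<^sup>c\<close> is
invertible, and these sets cover the quotient.\<close>

lemma cartier_if_divisor_class_in_generate:
  assumes "\<And>i. i \<le> n \<Longrightarrow> divisor_class n G \<omega> a \<in> generate G {\<omega> i}"
  shows "cartier TYPE('k::field) n G \<omega> a"
  unfolding cartier_def
proof
  fix z :: "(nat \<Rightarrow> 'k) set"
  assume "z \<in> fwps n G \<omega>"
  then obtain x where x: "x \<in> punctured_space n" "z = orbit_of n G \<omega> x" by (auto simp: fwps_def)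
  then obtain i where i: "i \<le> n" "x i \<noteq> 0" by (auto simp: punctured_space_def)
  obtain c :: int where c: "divisor_class n G \<omega> a = \<omega> i [^] c"
    using assms[OF i(1)] generate_pow[OF degree_closed[OF i(1)]] by auto
  define b' where "b' j = (if j = i then - c else 0)" for j
  define b where "b j = a j + b' j" for j
  have "divisor_class n G \<omega> b = \<omega> i [^] c \<otimes> \<omega> i [^] (- c)"
    unfolding b_def divisor_class_add c unfolding b'_def divisor_class_single[OF i(1)] ..
  then have degree_zero: "divisor_class n G \<omega> b = \<one>"
    using degree_closed[OF i(1)] by (simp add: int_pow_neg)
  define V where "V = {y::nat \<Rightarrow> 'k. y \<in> punctured_space n \<and> y i \<noteq> 0}"
  have V_open: "zariski_open n V"
    unfolding V_def by (intro zariski_open_nonvanishing polynomial_functions.coord i)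
  have V_act: "act n \<omega> h y \<in> V" if "h \<in> quasitorus G" "y \<in> V" for h :: "'g \<Rightarrow> 'k" and y
    using that act_punctured[OF that(1)] act_nonzero_iff[OF that(1) i(1)] by (simp add: V_def)
  define U where "U = orbit_of n G \<omega> ` V"
  define W :: "(nat \<Rightarrow> 'k) set set" where "W = orbit_of n G \<omega> ` torus n"
  have U: "fwps_open n G \<omega> U" "preimage n G \<omega> U = V"
    unfolding U_def by (intro fwps_open_orbits V_open V_act; assumption)+
  have W: "fwps_open n G \<omega> W" "preimage n G \<omega> W = torus n"
    unfolding W_def by (intro fwps_open_orbits zariski_open_torus act_torus; assumption)+
  \<comment> \<open>The definition evaluates the monomial at an arbitrary representative of the orbit; degree
    zero makes the choice irrelevant on the torus.\<close>
  define f :: "(nat \<Rightarrow> 'k) set \<Rightarrow> 'k" where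
    "f Z = laurent_monomial n b (SOME y. y \<in> punctured_space n \<and> orbit_of n G \<omega> y = Z)" for Z
  have f: "f (orbit_of n G \<omega> y) = laurent_monomial n b y" if "y \<in> torus n" for y
  proof -
    define y' where "y' = (SOME y'. y' \<in> punctured_space n \<and> orbit_of n G \<omega> y' = orbit_of n G \<omega> y)"
    have "y' \<in> punctured_space n \<and> orbit_of n G \<omega> y' = orbit_of n G \<omega> y"
      unfolding y'_def by (rule someI[of _ y]) (use that torus_subset in auto)
    then obtain h where h: "h \<in> quasitorus G" "y' = act n \<omega> h y" by (auto elim: orbit_of_eqE)
    have "h \<one> = 1" using quasitorus_int_pow[OF h(1) one_closed, of 0] by simp
    then show ?thesis
      unfolding f_def y'_def[symmetric] by (simp add: h laurent_monomial_act degree_zero)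
  qed
  have "(\<lambda>j\<in>{0..n}. 1) \<in> (torus n :: (nat \<Rightarrow> 'k) set)" by (auto simp: torus_def)
  then have "W \<noteq> {}" by (auto simp: W_def)
  moreover have "fwps_regular n G \<omega> W f"
    unfolding fwps_regular_def W(2)
    by (rule regular_laurent_monomial[where b = b, OF zariski_open_torus]) (auto simp: f, auto simp: torus_def)
  moreover have "regular n (preimage n G \<omega> U) (laurent_monomial n b' :: _ \<Rightarrow> 'k)"
    unfolding U(2)
    by (rule regular_laurent_monomial[where b = b', OF V_open])
      (auto simp: b'_def V_def split: if_splits)
  moreover have "laurent_monomial n b' y \<noteq> 0" if "y \<in> preimage n G \<omega> U" for y :: "nat \<Rightarrow> 'k"
    using that unfolding U(2) by (auto simp: laurent_monomial_def b'_def V_def)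
  moreover have "f (orbit_of n G \<omega> y) = (\<Prod>j\<in>{0..n}. y j powi a j) * laurent_monomial n b' y"
    if "y \<in> torus n" for y
    unfolding f[OF that] unfolding laurent_monomial_def prod.distrib[symmetric]
    by (rule prod.cong) (use that in \<open>auto simp: torus_def b_def power_int_add\<close>)
  ultimately have "principal_on TYPE('k) n G \<omega> a U"
    unfolding principal_on_def using W(1) by blast
  moreover have "z \<in> U" using x i by (auto simp: U_def V_def)
  ultimately show "\<exists>U. fwps_open n G \<omega> U \<and> z \<in> U \<and> principal_on TYPE('k) n G \<omega> a U"
    using U(1) by blast
qed

text \<open>Let \<open>\<kappa>\<close> be the class of \<open>a\<close>, and consider a local equation \<open>f = y\<^sup>a u\<close> near the orbit of the
\<open>i\<close>-th coordinate point \<open>e\<close>.  As \<open>f\<close> is invariant and \<open>y\<^sup>a\<close> has degree \<open>\<kappa>\<close>, the unit \<open>u\<close> satisfies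
\<open>h(\<kappa>) \<cdot> u(h \<cdot> y) = u(y)\<close> for generic \<open>y\<close>, hence, being regular, at \<open>e\<close> as well.  If \<open>h\<close> is trivial on
\<open>\<omega>\<^sub>i\<close>, it fixes \<open>e\<close>, and \<open>u(e) \<noteq> 0\<close> forces \<open>h(\<kappa>) = 1\<close>.  If \<open>\<kappa>\<close> were not in
\<open>\<langle>\<omega>\<^sub>i\<rangle>\<close>, some such \<open>h\<close> would have \<open>h(\<kappa>) \<noteq> 1\<close>.\<close>

lemma divisor_class_in_generate_if_cartier:
  assumes "cartier TYPE('k::{alg_closed_field,field_char_0}) n G \<omega> a" and i: "i \<le> n"
  shows "divisor_class n G \<omega> a \<in> generate G {\<omega> i}"
proof (rule ccontr)
  define \<kappa> where "\<kappa> = divisor_class n G \<omega> a"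
  assume "divisor_class n G \<omega> a \<notin> generate G {\<omega> i}"
  moreover have "subgroup (generate G {\<omega> i}) G"
    by (rule generate_is_subgroup) (use degree_closed[OF i] in simp)
  ultimately obtain h :: "'g \<Rightarrow> 'k" where h: "h \<in> quasitorus G" "h \<kappa> \<noteq> 1"
    and h_one: "\<And>x. x \<in> generate G {\<omega> i} \<Longrightarrow> h x = 1"
    using characters_separate[OF _ degrees_generate, of "generate G {\<omega> i}" \<kappa>] unfolding \<kappa>_def
    by (metis divisor_class_closed finite_atLeastAtMost finite_imageI)
  have h_i: "h (\<omega> i) = 1" by (rule h_one) (auto intro: generate.incl)
  define e :: "nat \<Rightarrow> 'k" where "e = (\<lambda>j\<in>{0..n}. if j = i then 1 else 0)"
  have e_ext: "e \<in> {0..n} \<rightarrow>\<^sub>E UNIV" by (simp add: e_def)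
  have e: "e \<in> punctured_space n" using i by (auto simp: punctured_space_def e_def)
  have act_e: "act n \<omega> h e = e" using h_i by (auto simp: act_def e_def)
  have "orbit_of n G \<omega> e \<in> fwps n G \<omega>" using e by (simp add: fwps_def)
  then obtain U where U: "orbit_of n G \<omega> e \<in> U" "principal_on TYPE('k) n G \<omega> a U"
    using assms(1) unfolding cartier_def by blast
  then obtain W f u where W: "fwps_open n G \<omega> W" "W \<noteq> {}"
    and u: "regular n (preimage n G \<omega> U) u" "\<forall>y\<in>preimage n G \<omega> U. u y \<noteq> 0"
    and f: "\<forall>y \<in> preimage n G \<omega> (U \<inter> W) \<inter> torus n.
           f (orbit_of n G \<omega> y) = laurent_monomial n a y * u y"
    unfolding principal_on_def laurent_monomial_def by blast
  have e_U: "e \<in> preimage n G \<omega> U" using e U(1) by (simp add: preimage_def)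
  then obtain V' g d where V': "V' \<subseteq> preimage n G \<omega> U" "zariski_open n V'" "e \<in> V'"
    and g: "g \<in> polynomial_functions n" and d: "d \<in> polynomial_functions n"
    and u_eq: "\<forall>y\<in>V'. d y \<noteq> 0 \<and> u y = g y / d y"
    using u(1) unfolding regular_def by blast
  obtain P where P: "P \<in> polynomial_functions n" "P e \<noteq> 0"
    and P_V': "\<And>y. y \<in> punctured_space n \<Longrightarrow> P y \<noteq> 0 \<Longrightarrow> y \<in> V'"
    using V'(2,3) unfolding zariski_open_def by blast
  obtain b R where R: "R \<in> polynomial_functions n" "R b \<noteq> 0" "b \<in> punctured_space n"
    and R_W: "\<And>y. y \<in> punctured_space n \<Longrightarrow> R y \<noteq> 0 \<Longrightarrow> y \<in> preimage n G \<omega> W"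
  proof -
    obtain b where "b \<in> preimage n G \<omega> W"
      using W by (auto simp: fwps_open_def fwps_def preimage_def)
    then show ?thesis using that W(1) unfolding fwps_open_def zariski_open_def by blast
  qed
  \<comment> \<open>The numerator of \<open>h(\<kappa>) \<cdot> u(h \<cdot> y) - u(y)\<close>, where \<open>u = g / d\<close>.  It vanishes at every point
    \<open>y\<close> where the equation for \<open>u\<close> is available, but not at \<open>e\<close>; irreducibility of affine space
    excludes this.\<close>
  define Q where "Q y = h \<kappa> * (g (act n \<omega> h y) * d y) - g y * d (act n \<omega> h y)" for y
  have Q: "Q \<in> polynomial_functions n"
    unfolding Q_def
    by (intro polynomial_functions_diff polynomial_functions.mult polynomial_functions.const g d
        polynomial_functions_act[OF g] polynomial_functions_act[OF d])
  have "u e \<noteq> 0" using u(2) e_U by blast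
  then have "g e \<noteq> 0" "d e \<noteq> 0" using u_eq V'(3) by auto
  then have Q_e: "Q e \<noteq> 0" using h(2) by (simp add: Q_def act_e algebra_simps)
  \<comment> \<open>Where \<open>N\<close>, \<open>R\<close> and \<open>T\<close> do not vanish, \<open>y\<close> and \<open>h \<cdot> y\<close> lie in the neighbourhood of \<open>e\<close> on which
    \<open>u = g / d\<close> holds, the orbit lies in \<open>W\<close>, and \<open>y\<close> lies in the torus.\<close>
  define N where "N y = Q y * (P y * P (act n \<omega> h y))" for y
  define T where "T y = (\<Prod>j\<in>{0..n}. y j)" for y :: "nat \<Rightarrow> 'k"
  have N: "N \<in> polynomial_functions n"
    unfolding N_def by (intro polynomial_functions.mult Q P(1) polynomial_functions_act[OF P(1)])
  have N_e: "N e \<noteq> 0" using Q_e P(2) by (simp add: N_def act_e)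
  have T: "T \<in> polynomial_functions n"
    unfolding T_def by (intro polynomial_functions_prod polynomial_functions.coord) auto
  have T_one: "T (\<lambda>j\<in>{0..n}. 1) \<noteq> 0" by (simp add: T_def)
  obtain b' where b': "b' \<in> {0..n} \<rightarrow>\<^sub>E UNIV" "R b' \<noteq> 0" "T b' \<noteq> 0"
    by (rule polynomial_functions_common_nonzero[OF R(1) T _ R(2) _ T_one])
      (use R(3) in \<open>auto simp: punctured_space_def\<close>)
  obtain y where y: "y \<in> {0..n} \<rightarrow>\<^sub>E UNIV" "N y \<noteq> 0" "R y * T y \<noteq> 0"
    by (rule polynomial_functions_common_nonzero[OF N polynomial_functions.mult[OF R(1) T]
        e_ext N_e b'(1)]) (use b' in auto)
  define y' where "y' = act n \<omega> h y"
  have y_torus: "y \<in> torus n" using y by (auto simp: torus_def T_def)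
  then have tori: "y \<in> punctured_space n" "y' \<in> torus n" "y' \<in> punctured_space n"
    unfolding y'_def using act_torus[OF h(1)] torus_subset by blast+
  have y_V': "y \<in> V'" "y' \<in> V'"
    using tori y(2) by (auto simp: N_def y'_def[symmetric] intro!: P_V')
  have "orbit_of n G \<omega> y' = orbit_of n G \<omega> y"
    unfolding y'_def by (rule orbit_of_act[OF h(1)])
  moreover have "y \<in> preimage n G \<omega> W" using y tori R_W by auto
  ultimately have "y \<in> preimage n G \<omega> (U \<inter> W)" "y' \<in> preimage n G \<omega> (U \<inter> W)"
    "f (orbit_of n G \<omega> y') = f (orbit_of n G \<omega> y)"
    using y_V' V'(1) tori by (auto simp: preimage_def)
  then have "laurent_monomial n a y' * u y' = laurent_monomial n a y * u y"
    using f y_torus tori by auto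
  moreover have "laurent_monomial n a y' = h \<kappa> * laurent_monomial n a y"
    unfolding y'_def \<kappa>_def by (rule laurent_monomial_act[OF h(1)])
  moreover have "laurent_monomial n a y \<noteq> 0"
    using y_torus by (auto simp: laurent_monomial_def torus_def)
  ultimately have "h \<kappa> * u y' = u y" by simp
  then have "Q y = 0"
    using u_eq y_V' unfolding Q_def y'_def[symmetric] by (auto simp: field_simps)
  then show False using y(2) by (simp add: N_def)
qed

text \<open>The stabilizer of the \<open>i\<close>-th coordinate point has character group \<open>G / \<langle>\<omega>\<^sub>i\<rangle>\<close>, and every stabilizer
of a point lies in one of these; a class is Cartier if and only if it is trivial, as a
character, on all of them.\<close>

theorem Pic_eq_Inter_generate:
  "Pic TYPE('k::{alg_closed_field,field_char_0}) n G \<omega> = (\<Inter>i\<in>{0..n}. generate G {\<omega> i})"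
proof (intro equalityI subsetI)
  fix \<kappa> assume "\<kappa> \<in> Pic TYPE('k) n G \<omega>"
  then show "\<kappa> \<in> (\<Inter>i\<in>{0..n}. generate G {\<omega> i})"
    using divisor_class_in_generate_if_cartier unfolding Pic_def divisor_class_def by auto
next
  fix \<kappa> assume \<kappa>: "\<kappa> \<in> (\<Inter>i\<in>{0..n}. generate G {\<omega> i})"
  then obtain c :: int where c: "\<kappa> = \<omega> 0 [^] c"
    using generate_pow[OF degree_closed[of 0]] INT_D[OF \<kappa>, of 0] by auto
  define a where "a = (\<lambda>j::nat. if j = 0 then c else 0)"
  have a: "\<kappa> = divisor_class n G \<omega> a" unfolding a_def c by (simp add: divisor_class_single)
  then have "cartier TYPE('k) n G \<omega> a" using \<kappa> by (intro cartier_if_divisor_class_in_generate) auto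
  then show "\<kappa> \<in> Pic TYPE('k) n G \<omega>" using a unfolding Pic_def divisor_class_def by blast
qed

end

section \<open>Arithmetic in the class group\<close>

lemma carrier_Cl:
  "carrier (Cl r \<mu>) = UNIV \<times> (\<Pi>\<^sub>E k\<in>{1..r}. carrier (integer_mod_group (\<mu> k)))"
  by (simp add: Cl_def DirProd_def)

lemma Cl_eqI:
  assumes "x \<in> carrier (Cl r \<mu>)" "y \<in> carrier (Cl r \<mu>)"
    and "fst x = fst y" "\<And>k. k \<in> {1..r} \<Longrightarrow> snd x k = snd y k"
  shows "x = y"
proof (rule prod_eqI)
  have "snd x \<in> (\<Pi>\<^sub>E k\<in>{1..r}. carrier (integer_mod_group (\<mu> k)))"
    "snd y \<in> (\<Pi>\<^sub>E k\<in>{1..r}. carrier (integer_mod_group (\<mu> k)))"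
    using assms(1,2) by (simp_all add: carrier_Cl mem_Times_iff)
  then show "snd x = snd y" by (rule PiE_ext) (rule assms(4))
qed (fact assms(3))

lemma fst_hom_Cl: "fst \<in> hom (Cl r \<mu>) integer_group"
  by (rule homI) (auto simp: Cl_def DirProd_def)

lemma snd_hom_Cl:
  assumes "k \<in> {1..r}"
  shows "(\<lambda>x. snd x k) \<in> hom (Cl r \<mu>) (integer_mod_group (\<mu> k))"
  by (rule homI) (use assms in \<open>auto simp: Cl_def DirProd_def\<close>)

lemma comm_group_Cl: "comm_group (Cl r \<mu>)"
proof -
  have "group (Cl r \<mu>)" unfolding Cl_def by (intro DirProd_group product_group) auto
  then show ?thesis
    by (rule group.group_comm_groupI) (auto simp: Cl_def DirProd_def add.commute)
qed

lemma Cl_pow: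
  assumes "g \<in> carrier (Cl r \<mu>)"
  shows "fst (g [^]\<^bsub>Cl r \<mu>\<^esub> (c::int)) = c * fst g"
    and "k \<in> {1..r} \<Longrightarrow> snd (g [^]\<^bsub>Cl r \<mu>\<^esub> c) k = c * snd g k mod int (\<mu> k)"
proof -
  interpret comm_group "Cl r \<mu>" by (rule comm_group_Cl)
  show "fst (g [^]\<^bsub>Cl r \<mu>\<^esub> c) = c * fst g"
    using hom_int_pow[OF fst_hom_Cl assms is_group, of c] by simp
  show "snd (g [^]\<^bsub>Cl r \<mu>\<^esub> c) k = c * snd g k mod int (\<mu> k)" if "k \<in> {1..r}"
    using hom_int_pow[OF snd_hom_Cl[OF that] assms is_group, of c]
    by (simp add: int_pow_integer_mod_group)
qed

lemma generate_single_Cl_iff: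
  assumes "g \<in> carrier (Cl r \<mu>)" "x \<in> carrier (Cl r \<mu>)"
  shows "x \<in> generate (Cl r \<mu>) {g} \<longleftrightarrow>
    (\<exists>c. fst x = c * fst g \<and> (\<forall>k\<in>{1..r}. snd x k = c * snd g k mod int (\<mu> k)))"
proof -
  interpret comm_group "Cl r \<mu>" by (rule comm_group_Cl)
  have iff: "x = g [^]\<^bsub>Cl r \<mu>\<^esub> c \<longleftrightarrow>
      fst x = c * fst g \<and> (\<forall>k\<in>{1..r}. snd x k = c * snd g k mod int (\<mu> k))" for c :: int
  proof
    assume "x = g [^]\<^bsub>Cl r \<mu>\<^esub> c"
    then show "fst x = c * fst g \<and> (\<forall>k\<in>{1..r}. snd x k = c * snd g k mod int (\<mu> k))"
      by (simp add: Cl_pow[OF assms(1)])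
  next
    assume *: "fst x = c * fst g \<and> (\<forall>k\<in>{1..r}. snd x k = c * snd g k mod int (\<mu> k))"
    show "x = g [^]\<^bsub>Cl r \<mu>\<^esub> c"
      by (rule Cl_eqI[OF assms(2) int_pow_closed[OF assms(1)]]) (use * in \<open>simp_all add: Cl_pow[OF assms(1)]\<close>)
  qed
  show ?thesis by (simp only: generate_pow[OF assms(1)] mem_Collect_eq UNIV_I simp_thms iff)
qed

lemma finprod_integer_group: "finite A \<Longrightarrow> finprod integer_group f A = sum f A"
proof (induction A rule: finite_induct)
  case empty
  interpret comm_group integer_group by (rule abelian_integer_group)
  show ?case by simp
next
  case (insert x A)
  interpret comm_group integer_group by (rule abelian_integer_group)
  show ?case using insert by (simp add: Pi_def)
qed

lemma fst_block_class_Cl: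
  assumes "finite B" "\<omega> \<in> B \<rightarrow> carrier (Cl r \<mu>)"
  shows "fst (block_class (Cl r \<mu>) \<omega> B) = (\<Sum>i\<in>B. fst (\<omega> i))"
  unfolding block_class_def
  using hom_finprod[OF comm_group_Cl abelian_integer_group fst_hom_Cl assms]
  by (simp only: finprod_integer_group[OF assms(1)])

lemma snd_block_class_Cl:
  assumes "finite B" "\<omega> \<in> B \<rightarrow> carrier (Cl r \<mu>)" "k \<in> {1..r}"
  shows "snd (block_class (Cl r \<mu>) \<omega> B) k = (\<Otimes>\<^bsub>integer_mod_group (\<mu> k)\<^esub>i\<in>B. snd (\<omega> i) k)"
  unfolding block_class_def
  by (rule hom_finprod[OF comm_group_Cl abelian_integer_mod_group snd_hom_Cl[OF assms(3)] assms(1,2)])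

lemma dvd_by_quotient_of_Gcd_iff:
  fixes m e :: int
  assumes "m > 0"
  shows "m div Gcd (insert m A) dvd e \<longleftrightarrow> (\<forall>a\<in>A. m dvd e * a)"
proof -
  define g where "g = Gcd (insert m A)"
  have "g dvd m" unfolding g_def by (rule Gcd_dvd) simp
  then obtain q where q: "m = g * q" by (elim dvdE)
  with assms have "g \<noteq> 0" by auto
  then have "m div g dvd e \<longleftrightarrow> m dvd e * g" by (simp add: q mult.commute)
  also have "\<dots> \<longleftrightarrow> m dvd normalize (e * g)" by simp
  also have "normalize (e * g) = Gcd ((*) e ` insert m A)" unfolding g_def by (simp only: Gcd_mult)
  also have "m dvd \<dots> \<longleftrightarrow> (\<forall>a\<in>A. m dvd e * a)" unfolding dvd_Gcd_iff by simp
  finally show ?thesis unfolding g_def .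
qed

lemma degree_matrix_positive:
  assumes "degree_matrix n r \<mu> \<omega>" "i \<le> n"
  shows "0 < fst (\<omega> i)"
  using assms(2)
proof (induction i)
  case 0
  then show ?case using assms(1) by (simp add: degree_matrix_def)
next
  case (Suc i)
  then have "fst (\<omega> i) \<le> fst (\<omega> (Suc i))" using assms(1) by (simp add: degree_matrix_def)
  then show ?case using Suc by simp
qed

text \<open>Any \<open>n\<close> of the degrees generate the group already, so the first \<open>n\<close> of them serve.\<close>

lemma degree_matrix_generates:
  assumes "degree_matrix n r \<mu> \<omega>"
  shows "generate (Cl r \<mu>) (\<omega> ` {0..n}) = carrier (Cl r \<mu>)"
proof -
  interpret comm_group "Cl r \<mu>" by (rule comm_group_Cl)
  have "generate (Cl r \<mu>) (\<omega> ` {0..<n}) = carrier (Cl r \<mu>)"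
  proof -
    have "{0..<n} \<subseteq> {0..n}" "card {0..<n} = n" by auto
    then show ?thesis using assms unfolding degree_matrix_def by blast
  qed
  moreover have "generate (Cl r \<mu>) (\<omega> ` {0..<n}) \<subseteq> generate (Cl r \<mu>) (\<omega> ` {0..n})"
    by (rule mono_generate) auto
  moreover have "generate (Cl r \<mu>) (\<omega> ` {0..n}) \<subseteq> carrier (Cl r \<mu>)"
    using assms by (intro generate_incl) (auto simp: degree_matrix_def)
  ultimately show ?thesis by blast
qed

lemma graded_coordinates_degree_matrix:
  assumes "degree_matrix n r \<mu> \<omega>"
  shows "graded_coordinates (Cl r \<mu>) n \<omega>"
proof (intro graded_coordinates.intro graded_coordinates_axioms.intro)
  show "\<omega> i \<in> carrier (Cl r \<mu>)" if "i \<le> n" for i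
    using assms that unfolding degree_matrix_def by simp
qed (rule comm_group_Cl degree_matrix_generates[OF assms])+

text \<open>Write \<open>x = (d, \<zeta>)\<close>.  From \<open>x = c \<cdot> (w, \<eta>)\<close> one gets \<open>d \<cdot> \<eta> = c w \<cdot> \<eta> = w \<cdot> \<zeta>\<close>, so the homomorphism
\<open>(v, \<xi>) \<mapsto> d \<cdot> \<xi> - v \<cdot> \<zeta>\<close> to \<open>\<int>/\<mu>\<^sub>k\<int>\<close> vanishes on all generators.  Hence it is zero, and its value at
\<open>(1, 0)\<close> is \<open>- \<zeta>\<close>.\<close>

lemma common_power_torsion_free:
  assumes gen: "generate (Cl r \<mu>) A = carrier (Cl r \<mu>)"
    and x: "x \<in> carrier (Cl r \<mu>)" and mult: "\<And>g. g \<in> A \<Longrightarrow> x \<in> generate (Cl r \<mu>) {g}"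
    and k: "k \<in> {1..r}" and pos: "0 < \<mu> k"
  shows "snd x k = 0"
proof -
  define \<phi> where "\<phi> y = (fst x * snd y k - fst y * snd x k) mod int (\<mu> k)" for y :: "int \<times> (nat \<Rightarrow> int)"
  have "\<phi> \<in> hom (Cl r \<mu>) (integer_mod_group (\<mu> k))"
  proof (rule homI)
    fix y z assume "y \<in> carrier (Cl r \<mu>)" "z \<in> carrier (Cl r \<mu>)"
    then have "fst (y \<otimes>\<^bsub>Cl r \<mu>\<^esub> z) = fst y + fst z"
      "snd (y \<otimes>\<^bsub>Cl r \<mu>\<^esub> z) k = (snd y k + snd z k) mod int (\<mu> k)"
      using hom_mult[OF fst_hom_Cl] hom_mult[OF snd_hom_Cl[OF k]] by auto
    moreover have "(fst x * ((snd y k + snd z k) mod int (\<mu> k)) - (fst y + fst z) * snd x k) mod int (\<mu> k)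
        = (fst x * (snd y k + snd z k) - (fst y + fst z) * snd x k) mod int (\<mu> k)"
      by (metis mod_diff_left_eq mod_mult_right_eq)
    ultimately show "\<phi> (y \<otimes>\<^bsub>Cl r \<mu>\<^esub> z) = \<phi> y \<otimes>\<^bsub>integer_mod_group (\<mu> k)\<^esub> \<phi> z"
      unfolding \<phi>_def by (simp add: mod_add_eq) (simp add: algebra_simps)
  qed (use pos in \<open>simp add: \<phi>_def carrier_integer_mod_group\<close>)
  then interpret group_hom "Cl r \<mu>" "integer_mod_group (\<mu> k)" \<phi>
    using comm_group.axioms(2)[OF comm_group_Cl] by (simp add: group_hom_def group_hom_axioms_def)
  have A: "A \<subseteq> carrier (Cl r \<mu>)" using gen generate.incl by fastforce
  have "\<phi> g = 0" if g: "g \<in> A" for g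
  proof -
    obtain c where c: "fst x = c * fst g" "snd x k = c * snd g k mod int (\<mu> k)"
      using mult[OF g] generate_single_Cl_iff[of g r \<mu> x] x A g k by blast
    have "int (\<mu> k) dvd snd x k - c * snd g k" by (subst mod_eq_dvd_iff[symmetric]) (simp add: c(2))
    then have "int (\<mu> k) dvd - fst g * (snd x k - c * snd g k)" by (rule dvd_mult)
    also have "- fst g * (snd x k - c * snd g k) = fst x * snd g k - fst g * snd x k"
      by (simp add: c(1) right_diff_distrib)
    finally show ?thesis unfolding \<phi>_def by (rule dvd_imp_mod_0)
  qed
  then have "A \<subseteq> kernel (Cl r \<mu>) (integer_mod_group (\<mu> k)) \<phi>"
    using A by (auto simp: kernel_def)
  then have "carrier (Cl r \<mu>) \<subseteq> kernel (Cl r \<mu>) (integer_mod_group (\<mu> k)) \<phi>"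
    using G.generate_subgroup_incl[OF _ subgroup_kernel] gen by auto
  moreover have "(1, \<lambda>k\<in>{1..r}. 0) \<in> carrier (Cl r \<mu>)" by (auto simp: carrier_Cl)
  ultimately have "\<phi> (1, \<lambda>k\<in>{1..r}. 0) = 0" by (auto simp: kernel_def)
  then have "(- snd x k) mod int (\<mu> k) = 0" using k by (simp add: \<phi>_def)
  then have "int (\<mu> k) dvd snd x k" by (simp only: mod_eq_0_iff_dvd dvd_minus_iff)
  then have "snd x k mod int (\<mu> k) = 0" by (rule dvd_imp_mod_0)
  moreover have "snd x k \<in> {0..<int (\<mu> k)}"
    using hom_in_carrier[OF snd_hom_Cl[OF k] x] pos by (simp add: carrier_integer_mod_group)
  ultimately show ?thesis by simp
qed

text \<open>If \<open>x = (d, \<zeta>)\<close> is \<open>c\<^sub>i \<cdot> \<omega>\<^sub>i\<close> for every \<open>i\<close>, then all weights divide \<open>d\<close>, so \<open>L\<close> does, and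
\<open>c\<^sub>i = (d / L) (L / w\<^sub>i)\<close>.  As \<open>\<zeta> = 0\<close>, all \<open>c\<^sub>i \<eta>\<^sub>i\<^sub>k\<close> are zero modulo \<open>\<mu>\<^sub>k\<close>, and the numbers \<open>e\<close> for
which all \<open>e (L / w\<^sub>i) \<eta>\<^sub>i\<^sub>k\<close> are zero modulo \<open>\<mu>\<^sub>k\<close> are exactly the multiples of \<open>M\<^sub>k\<close>.  These
steps can be reversed.\<close>

lemma Inter_generate_degrees_iff:
  assumes Q: "degree_matrix n r \<mu> \<omega>" and x: "x \<in> carrier (Cl r \<mu>)"
    and L: "L = Lcm ((\<lambda>i. fst (\<omega> i)) ` {0..n})"
    and M: "\<And>k. k \<in> {1..r} \<Longrightarrow> M k = int (\<mu> k) div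
      Gcd (insert (int (\<mu> k)) ((\<lambda>i. L div fst (\<omega> i) * snd (\<omega> i) k) ` {0..n}))"
  shows "x \<in> (\<Inter>i\<in>{0..n}. generate (Cl r \<mu>) {\<omega> i}) \<longleftrightarrow>
    L dvd fst x \<and> (\<forall>k\<in>{1..r}. M k dvd fst x div L) \<and> (\<forall>k\<in>{1..r}. snd x k = 0)"
proof -
  have "\<forall>k\<in>{1..r}. 1 \<le> \<mu> k" using Q unfolding degree_matrix_def by blast
  then have \<mu>: "0 < \<mu> k" if "k \<in> {1..r}" for k using that by force
  have "\<forall>i\<in>{0..n}. \<omega> i \<in> carrier (Cl r \<mu>)" using Q unfolding degree_matrix_def by blast
  then have \<omega>: "\<omega> i \<in> carrier (Cl r \<mu>)" if "i \<le> n" for i using that by simp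
  have w: "0 < fst (\<omega> i)" if "i \<le> n" for i using degree_matrix_positive[OF Q that] .
  have w_dvd_L: "fst (\<omega> i) dvd L" if "i \<le> n" for i unfolding L by (rule dvd_Lcm) (use that in auto)
  have M_dvd: "M k dvd e \<longleftrightarrow> (\<forall>i\<le>n. int (\<mu> k) dvd e * (L div fst (\<omega> i)) * snd (\<omega> i) k)"
    if "k \<in> {1..r}" for k e
    unfolding M[OF that] using \<mu>[OF that]
    by (subst dvd_by_quotient_of_Gcd_iff) (auto simp: mult.assoc)
  \<comment> \<open>The weights being positive, the first coordinate determines the multiplier.\<close>
  have coeff: "c = fst x div L * (L div fst (\<omega> i))"
    if "L dvd fst x" "fst x = c * fst (\<omega> i)" "i \<le> n" for c i
  proof -
    have "fst x = fst x div L * (L div fst (\<omega> i)) * fst (\<omega> i)"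
      using that(1) w_dvd_L[OF that(3)] by (simp add: mult.assoc)
    then show ?thesis using that(2) w[OF that(3)] by simp
  qed
  show ?thesis
  proof
    assume *: "x \<in> (\<Inter>i\<in>{0..n}. generate (Cl r \<mu>) {\<omega> i})"
    then have "\<exists>c. fst x = c * fst (\<omega> i) \<and> (\<forall>k\<in>{1..r}. snd x k = c * snd (\<omega> i) k mod int (\<mu> k))"
      if "i \<le> n" for i using generate_single_Cl_iff[OF \<omega>[OF that] x] that by auto
    then obtain c where c: "\<And>i. i \<le> n \<Longrightarrow> fst x = c i * fst (\<omega> i)"
      "\<And>i k. i \<le> n \<Longrightarrow> k \<in> {1..r} \<Longrightarrow> snd x k = c i * snd (\<omega> i) k mod int (\<mu> k)" by metis
    have torsion: "snd x k = 0" if "k \<in> {1..r}" for k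
      by (rule common_power_torsion_free[OF degree_matrix_generates[OF Q] x _ that \<mu>[OF that]])
        (use * in blast)
    have L_dvd: "L dvd fst x" unfolding L by (rule Lcm_least) (use c(1) in auto)
    then have "c i = fst x div L * (L div fst (\<omega> i))" if "i \<le> n" for i
      using coeff c(1) that by blast
    then have "M k dvd fst x div L" if "k \<in> {1..r}" for k
      unfolding M_dvd[OF that] using c(2) torsion that by (auto simp: mod_eq_0_iff_dvd[symmetric])
    then show "L dvd fst x \<and> (\<forall>k\<in>{1..r}. M k dvd fst x div L) \<and> (\<forall>k\<in>{1..r}. snd x k = 0)"
      using L_dvd torsion by blast
  next
    assume *: "L dvd fst x \<and> (\<forall>k\<in>{1..r}. M k dvd fst x div L) \<and> (\<forall>k\<in>{1..r}. snd x k = 0)"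
    have "x \<in> generate (Cl r \<mu>) {\<omega> i}" if i: "i \<le> n" for i
      unfolding generate_single_Cl_iff[OF \<omega>[OF i] x]
      using * M_dvd i w_dvd_L[OF i]
      by (intro exI[of _ "fst x div L * (L div fst (\<omega> i))"]) (auto simp: mult.assoc)
    then show "x \<in> (\<Inter>i\<in>{0..n}. generate (Cl r \<mu>) {\<omega> i})" by auto
  qed
qed

section \<open>Nef-partitions\<close>

theorem proposition3p1:
  fixes n r s :: nat
    and \<mu> :: "nat \<Rightarrow> nat"
    and \<omega> :: "nat \<Rightarrow> int \<times> (nat \<Rightarrow> int)"
    and w :: "nat \<Rightarrow> int"
    and \<eta> :: "nat \<Rightarrow> nat \<Rightarrow> int"
    and L :: int
    and M :: "nat \<Rightarrow> int"
    and p :: "nat \<Rightarrow> nat set"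
  assumes "degree_matrix n r \<mu> \<omega>"
    and "\<And>i. i \<in> {0..n} \<Longrightarrow> \<omega> i = (w i, \<eta> i)"
    and "L = Lcm (w ` {0..n})"
    and "\<And>k. k \<in> {1..r} \<Longrightarrow>
           M k = int (\<mu> k) div Gcd (insert (int (\<mu> k)) ((\<lambda>i. L div w i * \<eta> i k) ` {0..n}))"
    and "index_partition n s p"
  shows "nef_partition TYPE('k::{alg_closed_field, field_char_0}) n (Cl r \<mu>) \<omega> s p \<longleftrightarrow>
    (\<forall>j\<in>{1..s}. L dvd (\<Sum>i\<in>p j. w i)) \<and>
    (\<forall>j\<in>{1..s}. \<forall>k\<in>{1..r}. M k dvd (\<Sum>i\<in>p j. w i) div L) \<and>
    (\<forall>j\<in>{1..s}. \<forall>k\<in>{1..r}.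
       (\<Otimes>\<^bsub>integer_mod_group (\<mu> k)\<^esub>i\<in>p j. \<eta> i k) = \<one>\<^bsub>integer_mod_group (\<mu> k)\<^esub>) \<and>
    (\<forall>j\<in>{1..s}. \<forall>i\<in>{0..n}. block_class (Cl r \<mu>) \<omega> (p j) \<noteq> \<omega> i)"
proof -
  interpret graded_coordinates "Cl r \<mu>" n \<omega>
    by (rule graded_coordinates_degree_matrix[OF assms(1)])
  have L: "L = Lcm ((\<lambda>i. fst (\<omega> i)) ` {0..n})"
    using assms(2) unfolding assms(3) by (intro arg_cong[where f = Lcm] image_cong) auto
  have M: "M k = int (\<mu> k) div
      Gcd (insert (int (\<mu> k)) ((\<lambda>i. L div fst (\<omega> i) * snd (\<omega> i) k) ` {0..n}))"
    if "k \<in> {1..r}" for k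
    unfolding assms(4)[OF that] using assms(2)
    by (intro arg_cong2[where f = "(div)"] arg_cong[where f = Gcd] arg_cong2[where f = insert] image_cong)
      auto
  have Pic_iff: "block_class (Cl r \<mu>) \<omega> (p j) \<in> Pic TYPE('k) n (Cl r \<mu>) \<omega> \<longleftrightarrow>
      L dvd (\<Sum>i\<in>p j. w i) \<and> (\<forall>k\<in>{1..r}. M k dvd (\<Sum>i\<in>p j. w i) div L) \<and>
      (\<forall>k\<in>{1..r}. (\<Otimes>\<^bsub>integer_mod_group (\<mu> k)\<^esub>i\<in>p j. \<eta> i k) = \<one>\<^bsub>integer_mod_group (\<mu> k)\<^esub>)"
    if "j \<in> {1..s}" for j
  proof -
    have pj: "p j \<subseteq> {0..n}" using assms(5) that by (auto simp: index_partition_def)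
    then have fin: "finite (p j)" by (rule finite_subset) simp
    have closed: "\<omega> \<in> p j \<rightarrow> carrier (Cl r \<mu>)" using pj by auto
    have "block_class (Cl r \<mu>) \<omega> (p j) \<in> carrier (Cl r \<mu>)"
      unfolding block_class_def by (rule finprod_closed[OF closed])
    note iff = Inter_generate_degrees_iff[OF assms(1) this L M]
    have fst_eq: "fst (block_class (Cl r \<mu>) \<omega> (p j)) = (\<Sum>i\<in>p j. w i)"
      unfolding fst_block_class_Cl[OF fin closed] using assms(2) pj by (intro sum.cong) auto
    have snd_eq: "snd (block_class (Cl r \<mu>) \<omega> (p j)) k =
        (\<Otimes>\<^bsub>integer_mod_group (\<mu> k)\<^esub>i\<in>p j. \<eta> i k)" if k: "k \<in> {1..r}" for k
    proof -
      interpret Z: comm_group "integer_mod_group (\<mu> k)" by simp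
      have "snd (\<omega> i) k = \<eta> i k" if "i \<in> p j" for i using assms(2) pj that by auto
      moreover have "snd (\<omega> i) k \<in> carrier (integer_mod_group (\<mu> k))" if "i \<in> p j" for i
        using hom_in_carrier[OF snd_hom_Cl[OF k] funcset_mem[OF closed that]] .
      ultimately show ?thesis
        unfolding snd_block_class_Cl[OF fin closed k]
        by (intro Z.finprod_cong) (auto simp: simp_implies_def)
    qed
    show ?thesis unfolding Pic_eq_Inter_generate using iff by (simp add: fst_eq snd_eq)
  qed
  then show ?thesis using assms(5) unfolding nef_partition_def by blast
qed

end
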